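(* (a) Let $M$ be an arbitrary monoid (finite or infinite). Then the category of finite ordered $M$-sets and embeddings has the Ramsey property. (b) For every group $G$ (finite or infinite), the category of finite ordered $G$-sets and embeddings has the Ramsey property. (c) For every unary algebraic language $\Omega$ (finite or infinite), the category of finite ordered $\Omega$-algebras and embeddings has the Ramsey property.
   Context: An $M$-set is a pair $(A,\alpha)$ with $\alpha:M\times A\to A$ such that $\alpha(1,a)=a$ and $\alpha(m_1,\alpha(m_2,a))=\alpha(m_2\cdot m_1,a)$; a $G$-set is an $M$-set with $M=G$ a group. A unary algebraic language is a set of unary function symbols; an $\Omega$-algebra interprets each symbol as a unary operation on the underlying set. An ordered structure is one equipped additionally with a linear order on its underlying set; an embedding of ordered structures is a strictly increasing map that is a homomorphism ($f(\alpha(m,a))=\beta(m,f(a))$, resp. commuting with all operations). For a category $\mathcal C$, objects $A,B,C$ and integer $k\ge2$, write $C\longrightarrow(B)^A_k$ if for every map $\chi:\hom(A,C)\to\{0,\dots,k-1\}$ there is $w\in\hom(B,C)$ with $\chi$ constant on $\{w\cdot f:f\in\hom(A,B)\}$. $\mathcal C$ has the Ramsey property if for all $k\ge2$ and all objects $A,B$ there is an object $C$ with $C\longrightarrow(B)^A_k$. *)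

theory Defs
  imports "HOL-Algebra.Group" "HOL-Library.FuncSet"
begin

text \<open>
  Composition carries the domain, intermediate object and codomain as arguments, since a
  hom-set here is a family indexed by two objects and its members need not determine these.
\<close>

record ('o, 'h) category_data =
  Obj :: "'o set"
  Hom :: "'o \<Rightarrow> 'o \<Rightarrow> 'h set"
  Ident :: "'o \<Rightarrow> 'h"
  Comp :: "'o \<Rightarrow> 'o \<Rightarrow> 'o \<Rightarrow> 'h \<Rightarrow> 'h \<Rightarrow> 'h"

definition is_category :: "('o, 'h) category_data \<Rightarrow> bool" where
  "is_category \<C> \<longleftrightarrow>
     (\<forall>A\<in>Obj \<C>. Ident \<C> A \<in> Hom \<C> A A) \<and>
     (\<forall>A\<in>Obj \<C>. \<forall>B\<in>Obj \<C>. \<forall>C\<in>Obj \<C>. \<forall>f\<in>Hom \<C> A B. \<forall>g\<in>Hom \<C> B C.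
        Comp \<C> A B C g f \<in> Hom \<C> A C) \<and>
     (\<forall>A\<in>Obj \<C>. \<forall>B\<in>Obj \<C>. \<forall>f\<in>Hom \<C> A B.
        Comp \<C> A A B f (Ident \<C> A) = f \<and> Comp \<C> A B B (Ident \<C> B) f = f) \<and>
     (\<forall>A\<in>Obj \<C>. \<forall>B\<in>Obj \<C>. \<forall>C\<in>Obj \<C>. \<forall>D\<in>Obj \<C>.
        \<forall>f\<in>Hom \<C> A B. \<forall>g\<in>Hom \<C> B C. \<forall>h\<in>Hom \<C> C D.
        Comp \<C> A C D h (Comp \<C> A B C g f) = Comp \<C> A B D (Comp \<C> B C D h g) f)"

definition arrows :: "('o, 'h) category_data \<Rightarrow> 'o \<Rightarrow> 'o \<Rightarrow> 'o \<Rightarrow> nat \<Rightarrow> bool" where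
  "arrows \<C> C B A k \<longleftrightarrow>
     (\<forall>\<chi> \<in> Hom \<C> A C \<rightarrow> {0..<k}. \<exists>w\<in>Hom \<C> B C. \<exists>c. \<forall>f\<in>Hom \<C> A B. \<chi> (Comp \<C> A B C w f) = c)"

definition ramsey_property :: "('o, 'h) category_data \<Rightarrow> bool" where
  "ramsey_property \<C> \<longleftrightarrow>
     (\<forall>k\<ge>2. \<forall>A\<in>Obj \<C>. \<forall>B\<in>Obj \<C>. \<exists>C\<in>Obj \<C>. arrows \<C> C B A k)"

text \<open>
  Underlying sets are subsets of an ambient type \<^typ>\<open>'u\<close>. Operations and morphisms are
  extensional outside their domains, so that equality of structures and of morphisms is the
  set-theoretic one.
\<close>

record 'u ordered_set =
  carr :: "'u set"
  le :: "'u rel"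

definition finite_ordered_set :: "('u, 'x) ordered_set_scheme \<Rightarrow> bool" where
  "finite_ordered_set A \<longleftrightarrow> finite (carr A) \<and> linear_order_on (carr A) (le A)"

definition strictly_increasing ::
  "('u, 'x) ordered_set_scheme \<Rightarrow> ('u, 'x) ordered_set_scheme \<Rightarrow> ('u \<Rightarrow> 'u) \<Rightarrow> bool" where
  "strictly_increasing A B f \<longleftrightarrow>
     (\<forall>a\<in>carr A. \<forall>b\<in>carr A. (a, b) \<in> le A \<and> a \<noteq> b \<longrightarrow> (f a, f b) \<in> le B \<and> f a \<noteq> f b)"

record ('m, 'u) ordered_mset = "'u ordered_set" +
  act :: "'m \<times> 'u \<Rightarrow> 'u"

definition is_action :: "('m, 'z) monoid_scheme \<Rightarrow> 'u set \<Rightarrow> ('m \<times> 'u \<Rightarrow> 'u) \<Rightarrow> bool" where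
  "is_action M A \<alpha> \<longleftrightarrow>
     \<alpha> \<in> carrier M \<times> A \<rightarrow>\<^sub>E A \<and>
     (\<forall>a\<in>A. \<alpha> (\<one>\<^bsub>M\<^esub>, a) = a) \<and>
     (\<forall>m\<^sub>1\<in>carrier M. \<forall>m\<^sub>2\<in>carrier M. \<forall>a\<in>A. \<alpha> (m\<^sub>1, \<alpha> (m\<^sub>2, a)) = \<alpha> (m\<^sub>2 \<otimes>\<^bsub>M\<^esub> m\<^sub>1, a))"

definition mset_embeddings ::
  "('m, 'z) monoid_scheme \<Rightarrow> ('m, 'u) ordered_mset \<Rightarrow> ('m, 'u) ordered_mset \<Rightarrow> ('u \<Rightarrow> 'u) set" where
  "mset_embeddings M A B =
     {f \<in> carr A \<rightarrow>\<^sub>E carr B. strictly_increasing A B f \<and>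
        (\<forall>m\<in>carrier M. \<forall>a\<in>carr A. f (act A (m, a)) = act B (m, f a))}"

definition FinOrdMSet ::
  "('m, 'z) monoid_scheme \<Rightarrow> (('m, 'u) ordered_mset, 'u \<Rightarrow> 'u) category_data" where
  "FinOrdMSet M =
     \<lparr>Obj = {A. finite_ordered_set A \<and> is_action M (carr A) (act A)},
      Hom = mset_embeddings M,
      Ident = (\<lambda>A. \<lambda>x\<in>carr A. x),
      Comp = (\<lambda>A B C g f. compose (carr A) g f)\<rparr>"

record ('f, 'u) ordered_algebra = "'u ordered_set" +
  oper :: "'f \<Rightarrow> 'u \<Rightarrow> 'u"

definition is_unary_algebra :: "'f set \<Rightarrow> 'u set \<Rightarrow> ('f \<Rightarrow> 'u \<Rightarrow> 'u) \<Rightarrow> bool" where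
  "is_unary_algebra \<Omega> A F \<longleftrightarrow> F \<in> \<Omega> \<rightarrow>\<^sub>E (A \<rightarrow>\<^sub>E A)"

definition algebra_embeddings ::
  "'f set \<Rightarrow> ('f, 'u) ordered_algebra \<Rightarrow> ('f, 'u) ordered_algebra \<Rightarrow> ('u \<Rightarrow> 'u) set" where
  "algebra_embeddings \<Omega> A B =
     {h \<in> carr A \<rightarrow>\<^sub>E carr B. strictly_increasing A B h \<and>
        (\<forall>f\<in>\<Omega>. \<forall>a\<in>carr A. h (oper A f a) = oper B f (h a))}"

definition FinOrdAlg ::
  "'f set \<Rightarrow> (('f, 'u) ordered_algebra, 'u \<Rightarrow> 'u) category_data" where
  "FinOrdAlg \<Omega> =
     \<lparr>Obj = {A. finite_ordered_set A \<and> is_unary_algebra \<Omega> (carr A) (oper A)},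
      Hom = algebra_embeddings \<Omega>,
      Ident = (\<lambda>A. \<lambda>x\<in>carr A. x),
      Comp = (\<lambda>A B C g f. compose (carr A) g f)\<rparr>"

lemma strictly_increasing_id: "strictly_increasing A A (\<lambda>x\<in>carr A. x)"
  by (simp add: strictly_increasing_def)

lemma strictly_increasing_compose:
  assumes "f \<in> carr A \<rightarrow>\<^sub>E carr B" "strictly_increasing A B f" "strictly_increasing B C g"
  shows "strictly_increasing A C (compose (carr A) g f)"
  using assms PiE_mem[OF assms(1)] by (simp add: strictly_increasing_def compose_eq)

lemma compose_PiE:
  "f \<in> A \<rightarrow>\<^sub>E B \<Longrightarrow> g \<in> B \<rightarrow>\<^sub>E C \<Longrightarrow> compose A g f \<in> A \<rightarrow>\<^sub>E C"
  by (auto simp: PiE_iff compose_eq)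

lemma is_category_FinOrdMSet:
  fixes M :: "('m, 'z) monoid_scheme"
  shows "is_category (FinOrdMSet M :: (('m, 'u) ordered_mset, 'u \<Rightarrow> 'u) category_data)"
proof -
  have act_in: "act A (m, a) \<in> carr A"
    if "is_action M (carr A) (act A)" "m \<in> carrier M" "a \<in> carr A"
    for A :: "('m, 'u) ordered_mset" and m a
    using that by (auto simp: is_action_def PiE_iff)
  have 1: "(\<lambda>x\<in>carr A. x) \<in> mset_embeddings M A A"
    if "is_action M (carr A) (act A)" for A :: "('m, 'u) ordered_mset"
    using act_in[OF that] by (auto simp: mset_embeddings_def strictly_increasing_id)
  have 2: "compose (carr A) g f \<in> mset_embeddings M A C"
    if "is_action M (carr A) (act A)" "f \<in> mset_embeddings M A B" "g \<in> mset_embeddings M B C"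
    for A B C :: "('m, 'u) ordered_mset" and f g
    using that(2,3) act_in[OF that(1)]
    by (auto simp: mset_embeddings_def compose_eq extensional_arb[OF compose_extensional]
        intro: compose_PiE strictly_increasing_compose dest: PiE_mem)
  have in_Pi: "f \<in> carr A \<rightarrow> carr B" "f \<in> extensional (carr A)"
    if "f \<in> mset_embeddings M A B" for A B :: "('m, 'u) ordered_mset" and f
    using that by (auto simp: mset_embeddings_def PiE_def)
  show ?thesis
    unfolding is_category_def FinOrdMSet_def
    using 1 2 Id_compose[OF in_Pi] compose_Id[OF in_Pi]
    by (auto intro: compose_assoc[OF in_Pi(1)])
qed

lemma is_category_FinOrdAlg:
  fixes \<Omega> :: "'f set"
  shows "is_category (FinOrdAlg \<Omega> :: (('f, 'u) ordered_algebra, 'u \<Rightarrow> 'u) category_data)"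
proof -
  have oper_in: "oper A f a \<in> carr A"
    if "is_unary_algebra \<Omega> (carr A) (oper A)" "f \<in> \<Omega>" "a \<in> carr A"
    for A :: "('f, 'u) ordered_algebra" and f a
    using that by (auto simp: is_unary_algebra_def PiE_iff)
  have 1: "(\<lambda>x\<in>carr A. x) \<in> algebra_embeddings \<Omega> A A"
    if "is_unary_algebra \<Omega> (carr A) (oper A)" for A :: "('f, 'u) ordered_algebra"
    using oper_in[OF that] by (auto simp: algebra_embeddings_def strictly_increasing_id)
  have 2: "compose (carr A) g f \<in> algebra_embeddings \<Omega> A C"
    if "is_unary_algebra \<Omega> (carr A) (oper A)"
       "f \<in> algebra_embeddings \<Omega> A B" "g \<in> algebra_embeddings \<Omega> B C"
    for A B C :: "('f, 'u) ordered_algebra" and f g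
    using that(2,3) oper_in[OF that(1)]
    by (auto simp: algebra_embeddings_def compose_eq extensional_arb[OF compose_extensional]
        intro: compose_PiE strictly_increasing_compose dest: PiE_mem)
  have in_Pi: "f \<in> carr A \<rightarrow> carr B" "f \<in> extensional (carr A)"
    if "f \<in> algebra_embeddings \<Omega> A B" for A B :: "('f, 'u) ordered_algebra" and f
    using that by (auto simp: algebra_embeddings_def PiE_def)
  show ?thesis
    unfolding is_category_def FinOrdAlg_def
    using 1 2 Id_compose[OF in_Pi] compose_Id[OF in_Pi]
    by (auto intro: compose_assoc[OF in_Pi(1)])
qed

end

theory Submission
  imports Defs "HOL-Library.Ramsey"
begin

text \<open>
  For a set \<open>X\<close>, let \<open>M\<close> act on \<open>X\<^sup>M\<close> by \<open>(n \<cdot> \<phi>)(m) = \<phi>(nm)\<close>. This is the cofree \<open>M\<close>-set on \<open>X\<close>: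
  a map \<open>p : A \<rightarrow> X\<close> corresponds to the equivariant map \<open>a \<mapsto> (m \<mapsto> p(\<alpha>(m, a)))\<close>. If \<open>X\<close> is a finite
  chain and \<open>X\<^sup>M\<close> is ordered so that the value at \<open>1\<close> is compared first, strictly increasing
  maps \<open>p\<close> give embeddings. A colouring of embeddings of \<open>A\<close> hence induces a colouring of
  \<open>|A|\<close>-subsets of \<open>X\<close>, and a monochromatic \<open>|B|\<close>-subset given by Ramsey's theorem is the
  image of a map whose transpose is the required embedding of \<open>B\<close>. For finiteness with infinite
  \<open>M\<close> only the transposes of maps \<open>B \<rightarrow> X\<close> are kept. Unary algebras are \<open>M\<close>-sets for the free
  monoid \<open>M\<close>.
\<close>

section \<open>Increasing maps into a finite chain of naturals, and Ramsey's theorem for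
  them\<close>

definition increasing_maps :: "'a set \<Rightarrow> 'a rel \<Rightarrow> nat \<Rightarrow> ('a \<Rightarrow> nat) set" where
  "increasing_maps A r N =
     {p \<in> A \<rightarrow>\<^sub>E {..<N}. \<forall>a\<in>A. \<forall>b\<in>A. (a, b) \<in> r \<and> a \<noteq> b \<longrightarrow> p a < p b}"

lemma increasing_maps_less_iff:
  assumes "linear_order_on A r" "p \<in> increasing_maps A r N" "a \<in> A" "b \<in> A"
  shows "p a < p b \<longleftrightarrow> (a, b) \<in> r \<and> a \<noteq> b"
proof -
  have "a = b \<or> (a, b) \<in> r \<or> (b, a) \<in> r"
    using assms by (auto simp: order_on_defs total_on_def)
  moreover have "(a, b) \<in> r \<Longrightarrow> a \<noteq> b \<Longrightarrow> p a < p b" "(b, a) \<in> r \<Longrightarrow> a \<noteq> b \<Longrightarrow> p b < p a"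
    using assms by (auto simp: increasing_maps_def)
  ultimately show ?thesis
    by (metis less_asym less_irrefl)
qed

lemma increasing_maps_inj_on:
  assumes "linear_order_on A r" "p \<in> increasing_maps A r N"
  shows "inj_on p A"
proof (rule inj_onI, rule ccontr)
  fix a b assume ab: "a \<in> A" "b \<in> A" "p a = p b" "a \<noteq> b"
  then have "(a, b) \<in> r \<or> (b, a) \<in> r"
    using assms(1) by (auto simp: order_on_defs total_on_def)
  then show False
    using ab increasing_maps_less_iff[OF assms] by (metis less_irrefl)
qed

text \<open>The value at \<open>a\<close> is forced: it is the element of the image with exactly as
  many image elements below it as \<open>a\<close> has strict predecessors in \<open>A\<close>.
  Hence an increasing map can be recovered from its image, which lets colourings pass between maps
  and subsets.\<close>

lemma increasing_maps_eqI:
  assumes lin: "linear_order_on A r" and fin: "finite A"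
    and p: "p \<in> increasing_maps A r N" and q: "q \<in> increasing_maps A r N"
    and im: "p ` A = q ` A"
  shows "p = q"
proof (rule extensionalityI)
  show "p \<in> extensional A" "q \<in> extensional A"
    using p q by (auto simp: increasing_maps_def PiE_def)
  fix a assume a: "a \<in> A"
  have below: "card {t \<in> f ` A. t < f a} = card {b \<in> A. (b, a) \<in> r \<and> b \<noteq> a}"
    if f: "f \<in> increasing_maps A r N" for f
  proof -
    have "{t \<in> f ` A. t < f a} = f ` {b \<in> A. (b, a) \<in> r \<and> b \<noteq> a}"
      using increasing_maps_less_iff[OF lin f] a by auto
    moreover have "inj_on f {b \<in> A. (b, a) \<in> r \<and> b \<noteq> a}"
      using increasing_maps_inj_on[OF lin f] by (rule inj_on_subset) auto
    ultimately show ?thesis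
      by (simp add: card_image)
  qed
  \<comment> \<open>Among elements of the image, this count separates different values: the larger
    one has the smaller one additionally below it.\<close>
  have strict: "card {t \<in> p ` A. t < x} < card {t \<in> p ` A. t < y}" if "x \<in> p ` A" "x < y" for x y
    using that fin by (intro psubset_card_mono) auto
  have "card {t \<in> p ` A. t < p a} = card {t \<in> p ` A. t < q a}"
    using below[OF p] below[OF q] im by simp
  moreover have "p a \<in> p ` A" "q a \<in> p ` A"
    using a im by auto
  ultimately show "p a = q a"
    using strict[of "p a" "q a"] strict[of "q a" "p a"] by (cases "p a" "q a" rule: linorder_cases) simp_all
qed

text \<open>List \<open>H\<close> in increasing order and send the element of \<open>B\<close> with
  \<open>i\<close> strict predecessors to entry \<open>i\<close>, counting from 0.\<close>

lemma increasing_maps_onto: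
  assumes lin: "linear_order_on B s" and fin: "finite B"
    and H: "H \<subseteq> {..<N}" "card H = card B"
  obtains w where "w \<in> increasing_maps B s N" "w ` B = H"
proof -
  define xs where "xs = sorted_list_of_set H"
  define rank where "rank b = card {c \<in> B. (c, b) \<in> s \<and> c \<noteq> b}" for b
  define w where "w = (\<lambda>b\<in>B. xs ! rank b)"
  have finH: "finite H"
    using H(1) finite_subset by blast
  have xs: "set xs = H" "length xs = card B" "sorted_wrt (<) xs"
    using finH H by (simp_all add: xs_def)
  \<comment> \<open>An element is not its own strict predecessor, so the rank stays below
    \<open>card B\<close> and is a legal index into \<open>xs\<close>.\<close>
  have rank_less: "rank b < length xs" if "b \<in> B" for b
    unfolding rank_def xs(2) using that fin by (intro psubset_card_mono) auto
  have rank_mono: "rank a < rank b" if "a \<in> B" "b \<in> B" "(a, b) \<in> s" "a \<noteq> b" for a b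
  proof -
    have "trans s" "antisym s"
      using lin by (auto simp: order_on_defs)
    then have "{c \<in> B. (c, a) \<in> s \<and> c \<noteq> a} \<subset> {c \<in> B. (c, b) \<in> s \<and> c \<noteq> b}"
      using that by (auto dest: transD antisymD)
    then show ?thesis
      unfolding rank_def using fin by (intro psubset_card_mono) auto
  qed
  have wH: "w ` B \<subseteq> H"
    using rank_less xs(1) by (auto simp: w_def)
  have w: "w \<in> increasing_maps B s N"
    using wH H(1) rank_mono rank_less sorted_wrt_nth_less[OF xs(3)]
    by (auto simp: increasing_maps_def w_def)
  have "w ` B = H"
    using card_subset_eq[OF finH wH] card_image[OF increasing_maps_inj_on[OF lin w]] H(2) by simp
  with w show thesis ..
qed

text \<open>Taking images identifies increasing maps from \<open>A\<close> with subsets of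
  \<open>{..<N}\<close> of size \<open>card A\<close>, so Ramsey's theorem for hypergraphs applies.
  A homogeneous set of size \<open>card B\<close> is then the image of some increasing
  \<open>w\<close>.\<close>

lemma ramsey_increasing_maps:
  assumes A: "linear_order_on A r" "finite A" and B: "linear_order_on B s" "finite B"
  obtains N where
    "\<And>\<chi>. \<chi> \<in> increasing_maps A r N \<rightarrow> {..<k::nat} \<Longrightarrow> k > 0 \<Longrightarrow>
       \<exists>w \<in> increasing_maps B s N. \<exists>c. \<forall>p \<in> increasing_maps A r N. p ` A \<subseteq> w ` B \<longrightarrow> \<chi> p = c"
proof -
  obtain N :: nat where N: "partn_lst {..<N} (replicate k (card B)) (card A)"
    using ramsey_full by blast
  show thesis
  proof (rule that)
    fix \<chi> assume \<chi>: "\<chi> \<in> increasing_maps A r N \<rightarrow> {..<k}" and "k > 0"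
    \<comment> \<open>The colour of a set is that of the unique increasing map with this image.
      Ramsey's theorem asks for a colour on every set, so 0 serves as default; it is a legal colour
      because \<open>k > 0\<close>.\<close>
    define \<chi>' where "\<chi>' S = (if \<exists>p \<in> increasing_maps A r N. p ` A = S
      then \<chi> (SOME p. p \<in> increasing_maps A r N \<and> p ` A = S) else 0)" for S
    have \<chi>'_image: "\<chi>' (p ` A) = \<chi> p" if p: "p \<in> increasing_maps A r N" for p
    proof -
      have "(SOME q. q \<in> increasing_maps A r N \<and> q ` A = p ` A) = p"
        by (rule some_equality) (use p increasing_maps_eqI[OF A] in blast)+
      with p show ?thesis
        unfolding \<chi>'_def by auto
    qed
    have "\<chi>' S < k" for S
    proof (cases "\<exists>p \<in> increasing_maps A r N. p ` A = S")
      case True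
      then show ?thesis
        using \<chi>'_image \<chi> by fastforce
    next
      case False
      then show ?thesis
        using \<open>k > 0\<close> unfolding \<chi>'_def by simp
    qed
    then have "\<chi>' \<in> nsets {..<N} (card A) \<rightarrow> {..<k}"
      by blast
    then obtain i H where "i < k" "H \<in> nsets {..<N} (card B)"
      and mono: "\<chi>' ` nsets H (card A) \<subseteq> {i}"
      using N unfolding partn_lst_def monochromatic_def by fastforce
    then have "H \<subseteq> {..<N}" "card H = card B"
      by (auto simp: nsets_def)
    then obtain w where w: "w \<in> increasing_maps B s N" "w ` B = H"
      using increasing_maps_onto[OF B] by blast
    have "\<chi> p = i" if p: "p \<in> increasing_maps A r N" "p ` A \<subseteq> w ` B" for p
    proof -
      have "p ` A \<in> nsets H (card A)"
        using p w A(2) card_image[OF increasing_maps_inj_on[OF A(1) p(1)]] by (auto simp: nsets_def)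
      then show ?thesis
        using mono \<chi>'_image[OF p(1)] by auto
    qed
    then show "\<exists>w \<in> increasing_maps B s N. \<exists>c. \<forall>p \<in> increasing_maps A r N.
        p ` A \<subseteq> w ` B \<longrightarrow> \<chi> p = c"
      by (intro bexI[OF _ w(1)] exI[of _ i] ballI impI)
  qed
qed

section \<open>The Ramsey property for finite ordered \<open>M\<close>-sets\<close>

definition transpose_map ::
  "('m, 'z) monoid_scheme \<Rightarrow> ('m \<times> 'u \<Rightarrow> 'u) \<Rightarrow> ('u \<Rightarrow> nat) \<Rightarrow> 'u \<Rightarrow> 'm \<Rightarrow> nat" where
  "transpose_map M \<alpha> p a = (\<lambda>m\<in>carrier M. p (\<alpha> (m, a)))"

text \<open>This is the lexicographic order pulled back along \<open>g\<close>; injectivity supplies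
  antisymmetry.\<close>

lemma linear_order_on_key:
  fixes g :: "'a \<Rightarrow> nat \<times> nat"
  assumes "inj_on g U"
  shows "linear_order_on U {(x, y) \<in> U \<times> U.
    fst (g x) < fst (g y) \<or> fst (g x) = fst (g y) \<and> snd (g x) \<le> snd (g y)}"
  using assms
  by (auto simp: order_on_defs refl_on_def trans_def antisym_def total_on_def inj_on_def prod_eq_iff)

theorem ramsey_property_FinOrdMSet:
  fixes M :: "('m, 'z) monoid_scheme"
  assumes inf: "infinite (UNIV :: 'u set)" and "monoid M"
  shows "ramsey_property (FinOrdMSet M :: (('m, 'u) ordered_mset, 'u \<Rightarrow> 'u) category_data)"
proof -
  interpret monoid M by fact
  have "\<exists>C. finite_ordered_set C \<and> is_action M (carr C) (act C) \<and> arrows (FinOrdMSet M) C B A k"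
    if k: "k \<ge> 2" and oA: "finite_ordered_set A" and aA: "is_action M (carr A) (act A)"
      and oB: "finite_ordered_set B" and aB: "is_action M (carr B) (act B)"
    for k and A B :: "('m, 'u) ordered_mset"
  proof -
    have A: "linear_order_on (carr A) (le A)" "finite (carr A)"
      and B: "linear_order_on (carr B) (le B)" "finite (carr B)"
      using oA oB by (auto simp: finite_ordered_set_def)
    have actB: "act B (m, b) \<in> carr B" if "m \<in> carrier M" "b \<in> carr B" for m b
      using aB that by (auto simp: is_action_def)
    obtain N where N: "\<And>\<chi>. \<chi> \<in> increasing_maps (carr A) (le A) N \<rightarrow> {..<k} \<Longrightarrow> k > 0 \<Longrightarrow>
       \<exists>w \<in> increasing_maps (carr B) (le B) N. \<exists>c. \<forall>p \<in> increasing_maps (carr A) (le A) N.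
         p ` carr A \<subseteq> w ` carr B \<longrightarrow> \<chi> p = c"
      using ramsey_increasing_maps[OF A B, where k = k] by blast
    \<comment> \<open>The finite part of the cofree \<open>M\<close>-set that is kept. There are
      finitely many pairs of a map and a point of \<open>B\<close>, however large \<open>M\<close>
      is.\<close>
    define K where "K = case_prod (transpose_map M (act B)) ` ((carr B \<rightarrow>\<^sub>E {..<N}) \<times> carr B)"
    have "finite K"
      unfolding K_def using B(2) by (intro finite_imageI finite_cartesian_product finite_PiE) auto
    \<comment> \<open>Objects must live in the type \<open>'u\<close>, so the functions in
      \<open>K\<close> are coded by elements of a set \<open>U\<close> of equal size, with
      \<open>h\<close> encoding and \<open>d\<close> decoding. The infinite ambient type guarantees
      the room.\<close>
    obtain U :: "'u set" where U: "finite U" "card U = card K"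
      using infinite_arbitrarily_large[OF inf] by blast
    obtain h where h: "bij_betw h K U"
      using finite_same_card_bij[OF \<open>finite K\<close> U(1)] U(2) by auto
    define d where "d = inv_into K h"
    have dh: "d (h \<phi>) = \<phi>" if "\<phi> \<in> K" for \<phi>
      unfolding d_def using that h by (meson bij_betw_inv_into_left)
    have hd: "h (d x) = x" and dK: "d x \<in> K" if "x \<in> U" for x
      unfolding d_def using that h bij_betw_inv_into_right[OF h]
      by (auto simp: bij_betw_def inv_into_into)
    have hU: "h \<phi> \<in> U" if "\<phi> \<in> K" for \<phi>
      using h that bij_betwE by blast
    \<comment> \<open>An arbitrary tie-breaker for codes of functions that agree at the
      unit.\<close>
    obtain g :: "'u \<Rightarrow> nat" where g: "inj_on g U"
      using finite_imp_inj_to_nat_seg[OF U(1)] by blast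
    define shift where "shift n \<phi> = (\<lambda>m\<in>carrier M. \<phi> (n \<otimes>\<^bsub>M\<^esub> m))" for n and \<phi> :: "'m \<Rightarrow> nat"
    have shift_transpose: "shift n (transpose_map M \<alpha> p a) = transpose_map M \<alpha> p (\<alpha> (n, a))"
      if "is_action M S \<alpha>" "n \<in> carrier M" "a \<in> S" for \<alpha> S p n a
      using that unfolding shift_def transpose_map_def is_action_def by (auto intro!: restrict_ext)
    \<comment> \<open>Shifting the transpose of \<open>p\<close> at \<open>b\<close> keeps
      \<open>p\<close> and moves the point to \<open>act B (n, b)\<close>, so no function outside
      \<open>K\<close> arises.\<close>
    have shiftK: "shift n \<phi> \<in> K" if "n \<in> carrier M" "\<phi> \<in> K" for n \<phi>
      using that actB unfolding K_def by (force simp: shift_transpose[OF aB])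
    have shift_one: "shift \<one>\<^bsub>M\<^esub> \<phi> = \<phi>" if "\<phi> \<in> K" for \<phi>
      using that aB unfolding K_def by (auto simp: shift_transpose[OF aB] is_action_def)
    have shift_shift: "shift m (shift n \<phi>) = shift (n \<otimes>\<^bsub>M\<^esub> m) \<phi>"
      if "m \<in> carrier M" "n \<in> carrier M" for m n \<phi>
      using that unfolding shift_def by (auto intro!: restrict_ext simp: m_assoc)
    define C where "C = \<lparr>carr = U,
      le = {(x, y) \<in> U \<times> U. d x \<one>\<^bsub>M\<^esub> < d y \<one>\<^bsub>M\<^esub> \<or> d x \<one>\<^bsub>M\<^esub> = d y \<one>\<^bsub>M\<^esub> \<and> g x \<le> g y},
      act = (\<lambda>(m, x) \<in> carrier M \<times> U. h (shift m (d x)))\<rparr>"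
    have "inj_on (\<lambda>x. (d x \<one>\<^bsub>M\<^esub>, g x)) U"
      using g by (auto simp: inj_on_def)
    then have oC: "finite_ordered_set C"
      using linear_order_on_key[of "\<lambda>x. (d x \<one>\<^bsub>M\<^esub>, g x)" U] U(1)
      by (simp add: C_def finite_ordered_set_def)
    have aC: "is_action M (carr C) (act C)"
      unfolding is_action_def C_def
      using hU shiftK dK by (auto simp: shift_one hd dh shift_shift)
    define hat where "hat D p = (\<lambda>a\<in>carr D. h (transpose_map M (act D) p a))"
      for D :: "('m, 'u) ordered_mset" and p
    have at_one: "transpose_map M \<alpha> p a \<one>\<^bsub>M\<^esub> = p a" if "is_action M S \<alpha>" "a \<in> S" for \<alpha> S p a
      using that by (simp add: transpose_map_def is_action_def)
    have transposeK: "transpose_map M (act B) w b \<in> K"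
      if "w \<in> increasing_maps (carr B) (le B) N" "b \<in> carr B" for w b
      using that unfolding K_def increasing_maps_def by (auto intro!: image_eqI[where x = "(w, b)"])
    have hat_emb: "hat B w \<in> mset_embeddings M B C"
      if w: "w \<in> increasing_maps (carr B) (le B) N" for w
    proof -
      have "hat B w \<in> carr B \<rightarrow>\<^sub>E carr C"
        using hU transposeK[OF w] by (auto simp: hat_def C_def)
      \<comment> \<open>The transpose of \<open>w\<close> at \<open>b\<close> takes the value
        \<open>w b\<close> at the unit, so strict growth of \<open>w\<close> settles the comparison
        before \<open>g\<close> is consulted.\<close>
      moreover have "strictly_increasing B C (hat B w)"
        using w hU transposeK[OF w] unfolding strictly_increasing_def
        by (auto simp: hat_def C_def increasing_maps_def dh at_one[OF aB])
           (metis at_one[OF aB] dh transposeK[OF w] less_irrefl)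
      moreover have "hat B w (act B (m, b)) = act C (m, hat B w b)"
        if "m \<in> carrier M" "b \<in> carr B" for m b
        using that actB hU transposeK[OF w]
        by (simp add: hat_def C_def dh shift_transpose[OF aB])
      ultimately show ?thesis
        by (simp add: mset_embeddings_def)
    qed
    have "arrows (FinOrdMSet M) C B A k"
      unfolding arrows_def
    proof
      fix \<chi> assume "\<chi> \<in> Hom (FinOrdMSet M) A C \<rightarrow> {0..<k}"
      then have \<chi>: "\<chi> \<in> mset_embeddings M A C \<rightarrow> {..<k}"
        by (auto simp: FinOrdMSet_def)
      \<comment> \<open>For an increasing map \<open>p\<close> on \<open>A\<close>, the transposes
        may fall outside \<open>K\<close>, and then \<open>hat A p\<close> need not be an embedding
        into \<open>C\<close>. Such \<open>p\<close> receive the dummy colour 0; the maps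
        \<open>w\<close> after \<open>f\<close> used below are never of this kind.\<close>
      define \<chi>' where "\<chi>' p = (if hat A p \<in> mset_embeddings M A C then \<chi> (hat A p) else 0)" for p
      have "\<chi>' \<in> increasing_maps (carr A) (le A) N \<rightarrow> {..<k}" "k > 0"
        using \<chi> k by (auto simp: \<chi>'_def)
      from N[OF this] obtain w c where w: "w \<in> increasing_maps (carr B) (le B) N"
        and c: "\<forall>p \<in> increasing_maps (carr A) (le A) N. p ` carr A \<subseteq> w ` carr B \<longrightarrow> \<chi>' p = c"
        by (elim bexE exE)
      have "\<chi> (compose (carr A) (hat B w) f) = c" if f: "f \<in> mset_embeddings M A B" for f
      proof -
        have fB: "f a \<in> carr B" if "a \<in> carr A" for a
          using f that by (auto simp: mset_embeddings_def)
        have actA: "act A (m, a) \<in> carr A" if "m \<in> carrier M" "a \<in> carr A" for m a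
          using aA that by (auto simp: is_action_def)
        \<comment> \<open>Naturality of transposition: equivariance of \<open>f\<close> moves the
          action from \<open>A\<close> to \<open>B\<close>, so transposing \<open>w\<close> after
          \<open>f\<close> equals following \<open>f\<close> by the transpose of
          \<open>w\<close>.\<close>
        have eq: "hat A (compose (carr A) w f) = compose (carr A) (hat B w) f"
        proof (rule extensionalityI[of _ "carr A"])
          fix a assume a: "a \<in> carr A"
          have "transpose_map M (act A) (compose (carr A) w f) a = transpose_map M (act B) w (f a)"
            unfolding transpose_map_def using f a actA
            by (auto intro!: restrict_ext simp: compose_eq mset_embeddings_def)
          then show "hat A (compose (carr A) w f) a = compose (carr A) (hat B w) f a"
            using a fB by (simp add: hat_def compose_eq)
        qed (auto simp: hat_def compose_def)
        have "compose (carr A) (hat B w) f \<in> mset_embeddings M A C"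
          using is_category_FinOrdMSet[of M, where ?'u = 'u] oA oB oC aA aB aC f hat_emb[OF w]
          unfolding is_category_def FinOrdMSet_def by simp
        moreover have "compose (carr A) w f \<in> increasing_maps (carr A) (le A) N"
          using w f fB
          by (auto simp: increasing_maps_def compose_def mset_embeddings_def strictly_increasing_def)
        moreover have "compose (carr A) w f ` carr A \<subseteq> w ` carr B"
          using fB by (auto simp: compose_def)
        ultimately have "\<chi>' (compose (carr A) w f) = c"
          "hat A (compose (carr A) w f) \<in> mset_embeddings M A C"
          using c eq by auto
        then show ?thesis
          by (simp add: \<chi>'_def eq)
      qed
      then show "\<exists>w\<in>Hom (FinOrdMSet M) B C. \<exists>c. \<forall>f\<in>Hom (FinOrdMSet M) A B.
          \<chi> (Comp (FinOrdMSet M) A B C w f) = c"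
        using hat_emb[OF w] by (simp add: FinOrdMSet_def) blast
    qed
    with oC aC show ?thesis by blast
  qed
  then show ?thesis
    unfolding ramsey_property_def by (simp add: FinOrdMSet_def)
qed

section \<open>Unary algebras as sets over the free monoid\<close>

definition word_monoid :: "'f set \<Rightarrow> 'f list monoid" where
  "word_monoid \<Omega> = \<lparr>carrier = lists \<Omega>, mult = (@), one = []\<rparr>"

lemma monoid_word_monoid: "monoid (word_monoid \<Omega>)"
  by unfold_locales (auto simp: word_monoid_def)

text \<open>\<open>fold\<close> applies the first letter of a word first. This matches the action
  law, in which the left factor of a product acts first.\<close>

definition mset_of_algebra :: "'f set \<Rightarrow> ('f, 'u) ordered_algebra \<Rightarrow> ('f list, 'u) ordered_mset" where
  "mset_of_algebra \<Omega> A = \<lparr>carr = carr A, le = le A,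
     act = (\<lambda>(ws, a) \<in> lists \<Omega> \<times> carr A. fold (oper A) ws a)\<rparr>"

definition algebra_of_mset :: "'f set \<Rightarrow> ('f list, 'u) ordered_mset \<Rightarrow> ('f, 'u) ordered_algebra" where
  "algebra_of_mset \<Omega> C = \<lparr>carr = carr C, le = le C,
     oper = (\<lambda>f\<in>\<Omega>. \<lambda>a\<in>carr C. act C ([f], a))\<rparr>"

lemma fold_oper_closed:
  assumes "is_unary_algebra \<Omega> S F" "ws \<in> lists \<Omega>" "a \<in> S"
  shows "fold F ws a \<in> S"
  using assms(2,3)
proof (induction ws arbitrary: a)
  case (Cons f ws)
  then have "F f a \<in> S"
    using assms(1) by (auto simp: is_unary_algebra_def PiE_iff)
  with Cons show ?case by simp
qed simp

lemma is_action_mset_of_algebra: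
  assumes "is_unary_algebra \<Omega> (carr A) (oper A)"
  shows "is_action (word_monoid \<Omega>) (carr (mset_of_algebra \<Omega> A)) (act (mset_of_algebra \<Omega> A))"
  using fold_oper_closed[OF assms]
  by (auto simp: is_action_def word_monoid_def mset_of_algebra_def)

lemma is_unary_algebra_algebra_of_mset:
  assumes "is_action (word_monoid \<Omega>) (carr C) (act C)"
  shows "is_unary_algebra \<Omega> (carr (algebra_of_mset \<Omega> C)) (oper (algebra_of_mset \<Omega> C))"
  using assms
  by (auto simp: is_action_def word_monoid_def algebra_of_mset_def is_unary_algebra_def PiE_iff)

text \<open>Extensionality of the operations makes this an equality of records and not merely an
  isomorphism, so hom-sets can be rewritten along it.\<close>

lemma algebra_of_mset_of_algebra:
  assumes "is_unary_algebra \<Omega> (carr A) (oper A)"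
  shows "algebra_of_mset \<Omega> (mset_of_algebra \<Omega> A) = (A :: ('f, 'u) ordered_algebra)"
proof -
  have "(\<lambda>f\<in>\<Omega>. \<lambda>a\<in>carr A. oper A f a) = oper A"
  proof (rule extensionalityI[of _ \<Omega>])
    show "oper A \<in> extensional \<Omega>"
      using assms by (auto simp: is_unary_algebra_def PiE_def)
    fix f assume "f \<in> \<Omega>"
    then show "(\<lambda>f\<in>\<Omega>. \<lambda>a\<in>carr A. oper A f a) f = oper A f"
      using assms by (auto simp: is_unary_algebra_def PiE_def Pi_def intro: extensional_restrict)
  qed simp
  moreover have "oper (algebra_of_mset \<Omega> (mset_of_algebra \<Omega> A)) = (\<lambda>f\<in>\<Omega>. \<lambda>a\<in>carr A. oper A f a)"
    by (auto simp: algebra_of_mset_def mset_of_algebra_def intro!: restrict_ext)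
  ultimately show ?thesis
    by (simp add: algebra_of_mset_def mset_of_algebra_def)
qed

text \<open>Commuting with single letters extends to all words by induction on length, and
  conversely letters are words of length one. The orders and carriers are unchanged, so the hom-sets
  coincide literally.\<close>

lemma embeddings_algebra_of_mset:
  assumes A: "is_action (word_monoid \<Omega>) (carr A) (act A)"
    and C: "is_action (word_monoid \<Omega>) (carr C) (act C)"
  shows "algebra_embeddings \<Omega> (algebra_of_mset \<Omega> A) (algebra_of_mset \<Omega> C)
    = mset_embeddings (word_monoid \<Omega>) A C"
proof -
  have closed: "act D (ws, a) \<in> carr D"
    and nil: "act D ([], a) = a"
    and cons: "f \<in> \<Omega> \<Longrightarrow> act D (f # ws, a) = act D (ws, act D ([f], a))"
    if "is_action (word_monoid \<Omega>) (carr D) (act D)" "ws \<in> lists \<Omega>" "a \<in> carr D"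
    for D :: "('a list, 'b) ordered_mset" and ws f a
  proof -
    show "act D (ws, a) \<in> carr D" "act D ([], a) = a"
      using that by (auto simp: is_action_def word_monoid_def PiE_iff)
    assume "f \<in> \<Omega>"
    then have "act D (ws, act D ([f], a)) = act D ([f] @ ws, a)"
      using that unfolding is_action_def word_monoid_def by simp
    then show "act D (f # ws, a) = act D (ws, act D ([f], a))" by simp
  qed
  have "(\<forall>f\<in>\<Omega>. \<forall>a\<in>carr A. h (act A ([f], a)) = act C ([f], h a)) \<longleftrightarrow>
        (\<forall>ws\<in>lists \<Omega>. \<forall>a\<in>carr A. h (act A (ws, a)) = act C (ws, h a))" (is "?L \<longleftrightarrow> ?R")
    if h: "h \<in> carr A \<rightarrow>\<^sub>E carr C" for h
  proof
    assume L: ?L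
    show ?R
    proof
      fix ws assume "ws \<in> lists \<Omega>"
      then show "\<forall>a\<in>carr A. h (act A (ws, a)) = act C (ws, h a)"
      proof (induction ws)
        case Nil
        then show ?case
          using h nil[OF A, of "[]"] nil[OF C, of "[]"] by (auto simp: PiE_iff)
      next
        case (Cons f ws)
        show ?case
        proof
          fix a assume a: "a \<in> carr A"
          have "h a \<in> carr C" "act A ([f], a) \<in> carr A"
            using h a closed[OF A _ a] Cons.hyps by (auto simp: PiE_iff)
          \<comment> \<open>Peel off the first letter \<open>f\<close>, which acts first, and use
            the induction hypothesis at the point \<open>act A ([f], a)\<close>.\<close>
          then show "h (act A (f # ws, a)) = act C (f # ws, h a)"
            using Cons a L cons[OF A, of ws a f] cons[OF C, of ws "h a" f] by simp
        qed
      qed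
    qed
  next
    assume ?R
    then show ?L by simp
  qed
  moreover have "carrier (word_monoid \<Omega>) = lists \<Omega>"
    by (simp add: word_monoid_def)
  moreover have "(\<forall>f\<in>\<Omega>. \<forall>a\<in>carr A.
        h (oper (algebra_of_mset \<Omega> A) f a) = oper (algebra_of_mset \<Omega> C) f (h a))
      \<longleftrightarrow> (\<forall>f\<in>\<Omega>. \<forall>a\<in>carr A. h (act A ([f], a)) = act C ([f], h a))"
    if "h \<in> carr A \<rightarrow>\<^sub>E carr C" for h
    using PiE_mem[OF that] by (simp add: algebra_of_mset_def)
  moreover have "carr (algebra_of_mset \<Omega> D) = carr D" "le (algebra_of_mset \<Omega> D) = le D"
    for D :: "('a list, 'b) ordered_mset"
    by (simp_all add: algebra_of_mset_def)
  ultimately show ?thesis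
    unfolding algebra_embeddings_def mset_embeddings_def strictly_increasing_def
    by (intro Collect_cong) (simp cong: conj_cong del: in_lists_conv_set)
qed

text \<open>The Ramsey object for the associated sets over the word monoid is turned back into an
  algebra. Equal hom-sets and the same composition carry the arrow relation over unchanged.\<close>

theorem ramsey_property_FinOrdAlg:
  fixes \<Omega> :: "'f set"
  assumes inf: "infinite (UNIV :: 'u set)"
  shows "ramsey_property (FinOrdAlg \<Omega> :: (('f, 'u) ordered_algebra, 'u \<Rightarrow> 'u) category_data)"
  unfolding ramsey_property_def
proof (intro allI impI ballI)
  fix k :: nat and A B :: "('f, 'u) ordered_algebra"
  assume k: "2 \<le> k" and "A \<in> Obj (FinOrdAlg \<Omega>)" "B \<in> Obj (FinOrdAlg \<Omega>)"
  then have A: "finite_ordered_set A" "is_unary_algebra \<Omega> (carr A) (oper A)"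
    and B: "finite_ordered_set B" "is_unary_algebra \<Omega> (carr B) (oper B)"
    by (auto simp: FinOrdAlg_def)
  let ?M = "word_monoid \<Omega>"
  let ?A = "mset_of_algebra \<Omega> A" and ?B = "mset_of_algebra \<Omega> B"
  note actA = is_action_mset_of_algebra[OF A(2)] and actB = is_action_mset_of_algebra[OF B(2)]
  have "?A \<in> Obj (FinOrdMSet ?M)" "?B \<in> Obj (FinOrdMSet ?M)"
    using A(1) B(1) actA actB
    by (auto simp: FinOrdMSet_def finite_ordered_set_def mset_of_algebra_def)
  then obtain C where C: "C \<in> Obj (FinOrdMSet ?M)" and arr: "arrows (FinOrdMSet ?M) C ?B ?A k"
    using ramsey_property_FinOrdMSet[OF inf monoid_word_monoid] k
    unfolding ramsey_property_def by blast
  then have actC: "is_action ?M (carr C) (act C)"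
    by (simp add: FinOrdMSet_def)
  let ?C = "algebra_of_mset \<Omega> C"
  have "?C \<in> Obj (FinOrdAlg \<Omega>)"
    using C is_unary_algebra_algebra_of_mset[OF actC]
    by (simp add: FinOrdMSet_def FinOrdAlg_def finite_ordered_set_def algebra_of_mset_def)
  moreover have "arrows (FinOrdAlg \<Omega>) ?C B A k"
  proof -
    \<comment> \<open>The comparison of hom-sets speaks of algebras rebuilt from word actions; these
      equations replace the rebuilt ones by \<open>A\<close> and \<open>B\<close>
      themselves.\<close>
    note restore = algebra_of_mset_of_algebra[OF A(2)] algebra_of_mset_of_algebra[OF B(2)]
    have "algebra_embeddings \<Omega> A ?C = mset_embeddings ?M ?A C"
      "algebra_embeddings \<Omega> B ?C = mset_embeddings ?M ?B C"
      "algebra_embeddings \<Omega> A B = mset_embeddings ?M ?A ?B"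
      using embeddings_algebra_of_mset[OF actA actC] embeddings_algebra_of_mset[OF actB actC]
        embeddings_algebra_of_mset[OF actA actB]
      by (simp_all only: restore)
    moreover have "carr ?A = carr A"
      by (simp add: mset_of_algebra_def)
    ultimately show ?thesis
      using arr by (simp add: arrows_def FinOrdMSet_def FinOrdAlg_def)
  qed
  ultimately show "\<exists>C\<in>Obj (FinOrdAlg \<Omega>). arrows (FinOrdAlg \<Omega>) C B A k"
    by blast
qed

theorem theorem4p4:
  assumes "infinite (UNIV :: 'u set)"
  shows "(\<forall>M :: ('m, 'x) monoid_scheme. monoid M \<longrightarrow>
            ramsey_property (FinOrdMSet M :: (('m, 'u) ordered_mset, 'u \<Rightarrow> 'u) category_data)) \<and>
         (\<forall>G :: ('g, 'y) monoid_scheme. group G \<longrightarrow>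
            ramsey_property (FinOrdMSet G :: (('g, 'u) ordered_mset, 'u \<Rightarrow> 'u) category_data)) \<and>
         (\<forall>\<Omega> :: 'f set.
            ramsey_property (FinOrdAlg \<Omega> :: (('f, 'u) ordered_algebra, 'u \<Rightarrow> 'u) category_data))"
  by (intro conjI allI impI)
     (erule ramsey_property_FinOrdMSet[OF assms],
      erule ramsey_property_FinOrdMSet[OF assms group.is_monoid],
      rule ramsey_property_FinOrdAlg[OF assms])

end
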